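(* Let $\mu$ be a probability measure on $[0,1]^n$. If $\mu$ has local maximal dimension and is Federer, then $\mu$ is absolutely decaying, hence friendly.
   Context: $B_s(x)$ is the ball of radius $s$ centered at $x\in\mathbb R^n$ in the sup norm; $B(x,r)$ is the open ball in the Euclidean norm. For an affine hyperplane $\mathcal L\subset\mathbb R^n$, $d_{\mathcal L}(x)$ is the Euclidean distance from $x$ to $\mathcal L$, and $\mathcal L^{(\epsilon)}=\{x\in\mathbb R^n:d_{\mathcal L}(x)<\epsilon\}$. Measures on $[0,1]^n$ are regarded as (Radon) measures on $\mathbb R^n$ in the notions below. Local maximal dimension: a probability measure $\mu$ on $[0,1]^n$ has local maximal dimension if there exists $s_0>0$ such that for every $\epsilon>0$ there is $C_\epsilon>0$ with $\mu(B_{\delta s}(x))\le C_\epsilon\,\delta^{n-\epsilon}\mu(B_s(x))$ for all $0<\delta<1$, $0<s\le s_0$, $x\in[0,1]^n$. Federer: $\mu$ is Federer on an open set $U$ if there exist $c,\beta>0$ such that $\mu(B(x,\delta))\ge c(\delta/s)^\beta\mu(B(x,s))$ for all $x\in\mathrm{supp}(\mu)\cap U$ and $0<\delta\le s$ with $B(x,s)\subset U$. $\mu$ is Federer if $\mu$-a.e. $x$ has a neighborhood $U$ on which $\mu$ is Federer. Absolutely decaying: for $C,\alpha>0$, $\mu$ is absolutely $(C,\alpha)$-decaying on an open set $U$ if for every non-empty open ball $B=B(z,r)\subset U$ with $z\in\mathrm{supp}(\mu)$, every affine hyperplane $\mathcal L$ and every $\epsilon>0$, $\mu(B\cap\mathcal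 L^{(\epsilon)})\le C(\epsilon/r)^\alpha\mu(B)$. $\mu$ is absolutely decaying if for $\mu$-a.e. $y_0$ there are a neighborhood $U$ of $y_0$ and $C,\alpha>0$ such that $\mu$ is absolutely $(C,\alpha)$-decaying on $U$. Friendly (Kleinbock–Lindenstrauss–Weiss): $\mu$ is friendly if it is Federer, nonplanar and decaying. Nonplanar: $\mu(\mathcal L)=0$ for every affine hyperplane $\mathcal L$. Decaying: for $\mu$-a.e. $y_0$ there are a neighborhood $U$ of $y_0$ and $C,\alpha>0$ such that for every non-empty open ball $B\subset U$ centered in $\mathrm{supp}(\mu)$, every affine hyperplane $\mathcal L$ and every $\epsilon>0$, $\mu\big(B\cap\mathcal L^{(\epsilon\|d_{\mathcal L}\|_{\mu,B})}\big)\le C\epsilon^\alpha\mu(B)$, where $\|d_{\mathcal L}\|_{\mu,B}=\sup_{y\in B\cap\mathrm{supp}(\mu)}d_{\mathcal L}(y)$. *)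

theory Defs
  imports "HOL-Probability.Probability"
begin

(* Euclidean n-space is real^'n with n = CARD('n), and the unit cube [0,1]^n is cbox 0 1.
   All measures below are meant to be finite Borel measures; inequalities between values are
   stated through the real-valued function measure, which is the genuine value in that case. *)

definition msupp :: "(real^'n) measure \<Rightarrow> (real^'n) set" where
  "msupp \<mu> = {x. \<forall>U. open U \<and> x \<in> U \<longrightarrow> emeasure \<mu> U > 0}"

(* Open ball. Replacing it by the closed ball gives an equivalent notion of local maximal
   dimension, with the same constants, by continuity of the measure along
   monotone families of balls. *)
definition sup_ball :: "real^'n \<Rightarrow> real \<Rightarrow> (real^'n) set" where
  "sup_ball x s = {y. infnorm (y - x) < s}"

definition affine_hyperplane :: "(real^'n) set \<Rightarrow> bool" where
  "affine_hyperplane L \<longleftrightarrow> (\<exists>a b. a \<noteq> 0 \<and> L = {x. a \<bullet> x = b})"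

definition hyp_nbhd :: "(real^'n) set \<Rightarrow> real \<Rightarrow> (real^'n) set" where
  "hyp_nbhd L \<epsilon> = {x. infdist x L < \<epsilon>}"

definition local_maximal_dimension :: "(real^'n) measure \<Rightarrow> bool" where
  "local_maximal_dimension \<mu> \<longleftrightarrow>
     (\<exists>s0>0. \<forall>\<epsilon>>0. \<exists>C>0. \<forall>\<delta> s. \<forall>x\<in>cbox 0 1.
        0 < \<delta> \<and> \<delta> < 1 \<and> 0 < s \<and> s \<le> s0 \<longrightarrow>
        measure \<mu> (sup_ball x (\<delta> * s))
          \<le> C * \<delta> powr (real CARD('n) - \<epsilon>) * measure \<mu> (sup_ball x s))"

definition federer_on :: "(real^'n) measure \<Rightarrow> (real^'n) set \<Rightarrow> bool" where
  "federer_on \<mu> U \<longleftrightarrow>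
     (\<exists>c>0. \<exists>\<beta>>0. \<forall>x \<in> msupp \<mu> \<inter> U. \<forall>\<delta> s.
        0 < \<delta> \<and> \<delta> \<le> s \<and> ball x s \<subseteq> U \<longrightarrow>
        measure \<mu> (ball x \<delta>) \<ge> c * (\<delta> / s) powr \<beta> * measure \<mu> (ball x s))"

definition federer :: "(real^'n) measure \<Rightarrow> bool" where
  "federer \<mu> \<longleftrightarrow> (AE x in \<mu>. \<exists>U. open U \<and> x \<in> U \<and> federer_on \<mu> U)"

definition absolutely_decaying_on ::
    "real \<Rightarrow> real \<Rightarrow> (real^'n) measure \<Rightarrow> (real^'n) set \<Rightarrow> bool" where
  "absolutely_decaying_on C \<alpha> \<mu> U \<longleftrightarrow>
     (\<forall>z r L \<epsilon>. z \<in> msupp \<mu> \<and> 0 < r \<and> ball z r \<subseteq> U \<and> affine_hyperplane L \<and> 0 < \<epsilon> \<longrightarrow>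
        measure \<mu> (ball z r \<inter> hyp_nbhd L \<epsilon>) \<le> C * (\<epsilon> / r) powr \<alpha> * measure \<mu> (ball z r))"

definition absolutely_decaying :: "(real^'n) measure \<Rightarrow> bool" where
  "absolutely_decaying \<mu> \<longleftrightarrow>
     (AE y in \<mu>. \<exists>U C \<alpha>. open U \<and> y \<in> U \<and> 0 < C \<and> 0 < \<alpha> \<and> absolutely_decaying_on C \<alpha> \<mu> U)"

definition nonplanar :: "(real^'n) measure \<Rightarrow> bool" where
  "nonplanar \<mu> \<longleftrightarrow> (\<forall>L. affine_hyperplane L \<longrightarrow> emeasure \<mu> L = 0)"

(* Below, B is a ball centred in the support, so the supremum is over a nonempty set
   on which the distance is bounded. *)
definition dist_norm :: "(real^'n) measure \<Rightarrow> (real^'n) set \<Rightarrow> (real^'n) set \<Rightarrow> real" where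
  "dist_norm \<mu> B L = (SUP y \<in> B \<inter> msupp \<mu>. infdist y L)"

definition decaying_on ::
    "real \<Rightarrow> real \<Rightarrow> (real^'n) measure \<Rightarrow> (real^'n) set \<Rightarrow> bool" where
  "decaying_on C \<alpha> \<mu> U \<longleftrightarrow>
     (\<forall>z r L \<epsilon>. z \<in> msupp \<mu> \<and> 0 < r \<and> ball z r \<subseteq> U \<and> affine_hyperplane L \<and> 0 < \<epsilon> \<longrightarrow>
        measure \<mu> (ball z r \<inter> hyp_nbhd L (\<epsilon> * dist_norm \<mu> (ball z r) L))
          \<le> C * \<epsilon> powr \<alpha> * measure \<mu> (ball z r))"

definition decaying :: "(real^'n) measure \<Rightarrow> bool" where
  "decaying \<mu> \<longleftrightarrow>
     (AE y in \<mu>. \<exists>U C \<alpha>. open U \<and> y \<in> U \<and> 0 < C \<and> 0 < \<alpha> \<and> decaying_on C \<alpha> \<mu> U)"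

definition friendly :: "(real^'n) measure \<Rightarrow> bool" where
  "friendly \<mu> \<longleftrightarrow> federer \<mu> \<and> nonplanar \<mu> \<and> decaying \<mu>"

end

theory Submission
  imports Defs
begin

text \<open>
  The argument is a count of boxes. Fix a ball \<open>B\<close> of radius \<open>r\<close> centred in the support and a
  slab of half-width \<open>\<epsilon>\<close> around a hyperplane. Because the slab is thin in one direction, its part
  inside \<open>B\<close> is covered by \<open>O((r/\<epsilon>)\<^bsup>n-1\<^esup>)\<close> sup-norm balls of radius comparable to \<open>\<epsilon>\<close>, centred at
  points of the slab (\<open>slab_cover\<close>). Local maximal dimension, used with the loss \<open>1/2\<close> in
  the exponent, says that each of these has measure at most \<open>O((\<epsilon>/r)\<^bsup>n-1/2\<^esup>)\<close> times that of
  a concentric ball of radius \<open>r\<close>. The Federer condition bounds the measure of this larger ball by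
  a constant times \<open>\<mu>(B)\<close>. Multiplying, the slab has measure at most \<open>O((\<epsilon>/r)\<^bsup>1/2\<^esup>) \<mu>(B)\<close>: absolute
  decay with exponent \<open>1/2\<close> (\<open>slab_measure_le\<close>, \<open>absolutely_decaying_if_federer\<close>). Any loss
  smaller than \<open>1\<close> would do.

  Friendliness is then formal. Decay follows because the distance to a hyperplane is 1-Lipschitz:
  when its supremum on \<open>B\<close> is much larger than \<open>r\<close>, the distance is at least half of it
  throughout \<open>B\<close>, and otherwise absolute decay applies. Nonplanarity follows by letting \<open>\<epsilon>\<close>
  tend to \<open>0\<close>, which shows that a hyperplane is null locally, hence null by the Lindelof
  property.
\<close>

section \<open>Covering a hyperplane slab by sup-norm balls\<close>

lemma mem_sup_ball_if_coords:
  fixes x y :: "real^'n"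
  assumes "\<And>j. \<bar>y $ j - x $ j\<bar> < s"
  shows "y \<in> sup_ball x s"
proof -
  have "infnorm (y - x) < s"
    unfolding infnorm_Max using assms
    by (subst Max_less_iff) (auto simp: Basis_vec_def inner_axis)
  then show ?thesis by (simp add: sup_ball_def)
qed

lemma sup_ball_subset_ball:
  fixes x :: "real^'n"
  assumes "0 < s"
  shows "sup_ball x s \<subseteq> ball x (real CARD('n) * s)"
proof
  fix y assume "y \<in> sup_ball x s"
  then have lt: "\<bar>(y - x) $ j\<bar> < s" for j
    using component_le_infnorm_cart[of "y - x" j] by (simp add: sup_ball_def)
  have "norm (y - x) \<le> (\<Sum>j\<in>UNIV. \<bar>(y - x) $ j\<bar>)"
    by (rule norm_le_l1_cart)
  also have "\<dots> < (\<Sum>j\<in>(UNIV :: 'n set). s)"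
    by (rule sum_strict_mono) (use lt in auto)
  finally show "y \<in> ball x (real CARD('n) * s)"
    by (simp add: dist_norm norm_minus_commute)
qed

lemma open_sup_ball: "open (sup_ball (x :: real^'n) s)"
  unfolding sup_ball_def
  by (intro open_Collect_less continuous_intros)

lemma open_hyp_nbhd: "open (hyp_nbhd L \<epsilon>)"
  unfolding hyp_nbhd_def
  by (intro open_Collect_less continuous_intros)

lemma hyperplane_nonempty:
  fixes a :: "real^'n"
  assumes "a \<noteq> 0"
  shows "{x. a \<bullet> x = b} \<noteq> {}"
proof -
  have "a \<bullet> ((b / (a \<bullet> a)) *\<^sub>R a) = b" using assms by simp
  then show ?thesis by blast
qed

lemma hyp_nbhd_inner_bound:
  fixes a :: "real^'n"
  assumes "a \<noteq> 0" "x \<in> hyp_nbhd {x. a \<bullet> x = b} \<epsilon>"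
  shows "\<bar>a \<bullet> x - b\<bar> \<le> norm a * \<epsilon>"
proof -
  let ?L = "{x. a \<bullet> x = b}"
  have ne: "?L \<noteq> {}" by (rule hyperplane_nonempty[OF assms(1)])
  have "(INF y\<in>?L. dist x y) < \<epsilon>"
    using assms(2) ne unfolding hyp_nbhd_def infdist_notempty[OF ne] by blast
  then obtain y where y: "a \<bullet> y = b" "dist x y < \<epsilon>"
    using ne by (subst (asm) cINF_less_iff) auto
  have "\<bar>a \<bullet> x - b\<bar> = \<bar>a \<bullet> (x - y)\<bar>" using y by (simp add: inner_diff_right)
  also have "\<dots> \<le> norm a * norm (x - y)" by (rule Cauchy_Schwarz_ineq2)
  also have "\<dots> \<le> norm a * \<epsilon>" using y(2) by (intro mult_left_mono) (auto simp: dist_norm)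
  finally show ?thesis .
qed

text \<open>
  The slab is a graph of controlled slope, up to an error of order \<open>\<epsilon>\<close>, over the coordinate
  hyperplane orthogonal to the \<open>i\<close>-th axis, where \<open>i\<close> is a largest coordinate of the normal vector:
  solving \<open>a \<bullet> (x - y) = O(\<parallel>a\<parallel> \<epsilon>)\<close> for the \<open>i\<close>-th coordinate divides by \<open>\<bar>a\<^sub>i\<bar>\<close>, which
  dominates all other coefficients.
\<close>

lemma slab_dominant_coordinate:
  fixes L :: "(real^'n) set"
  assumes "affine_hyperplane L"
  obtains i where "\<And>x y \<epsilon> j. \<lbrakk>x \<in> hyp_nbhd L \<epsilon>; y \<in> hyp_nbhd L \<epsilon>;
      \<And>j. j \<noteq> i \<Longrightarrow> \<bar>y $ j - x $ j\<bar> \<le> \<epsilon>\<rbrakk> \<Longrightarrow> \<bar>y $ j - x $ j\<bar> \<le> 3 * real CARD('n) * \<epsilon>"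
proof -
  let ?n = "real CARD('n)"
  obtain a b where a: "a \<noteq> 0" and L: "L = {x. a \<bullet> x = b}"
    using assms by (auto simp: affine_hyperplane_def)
  have "\<exists>i. \<forall>j. \<bar>a $ j\<bar> \<le> \<bar>a $ i\<bar>"
  proof -
    have "Max (range (\<lambda>j. \<bar>a $ j\<bar>)) \<in> range (\<lambda>j. \<bar>a $ j\<bar>)" by (intro Max_in) auto
    then obtain i where "Max (range (\<lambda>j. \<bar>a $ j\<bar>)) = \<bar>a $ i\<bar>" by (rule rangeE)
    then show ?thesis by (metis Max_ge finite finite_imageI rangeI)
  qed
  then obtain i where i: "\<And>j. \<bar>a $ j\<bar> \<le> \<bar>a $ i\<bar>" by blast
  have ai: "\<bar>a $ i\<bar> > 0"
  proof (rule ccontr)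
    assume "\<not> \<bar>a $ i\<bar> > 0"
    then have "a $ j = 0" for j using i[of j] by auto
    then show False using a by (simp add: vec_eq_iff)
  qed
  have na: "norm a \<le> ?n * \<bar>a $ i\<bar>"
    using norm_le_l1_cart[of a] sum_bounded_above[of UNIV "\<lambda>j. \<bar>a $ j\<bar>" "\<bar>a $ i\<bar>"] i by auto
  show ?thesis
  proof (rule that)
    fix x y \<epsilon> j
    assume x: "x \<in> hyp_nbhd L \<epsilon>" and y: "y \<in> hyp_nbhd L \<epsilon>"
      and close: "\<And>j. j \<noteq> i \<Longrightarrow> \<bar>y $ j - x $ j\<bar> \<le> \<epsilon>"
    have eps: "0 \<le> \<epsilon>" using x infdist_nonneg[of x L] by (auto simp: hyp_nbhd_def)
    have n1: "1 \<le> ?n" using zero_less_card_finite[where 'a='n] by linarith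
    define v where "v = y - x"
    have "a \<bullet> v = (\<Sum>j\<in>UNIV. a $ j * v $ j)" by (simp add: inner_vec_def)
    also have "\<dots> = a $ i * v $ i + (\<Sum>j\<in>UNIV - {i}. a $ j * v $ j)"
      by (rule sum.remove) auto
    finally have "\<bar>a $ i * v $ i\<bar> \<le> \<bar>a \<bullet> v\<bar> + \<bar>\<Sum>j\<in>UNIV - {i}. a $ j * v $ j\<bar>" by linarith
    moreover have "\<bar>a \<bullet> v\<bar> \<le> 2 * (?n * \<bar>a $ i\<bar> * \<epsilon>)"
    proof -
      have "\<bar>a \<bullet> v\<bar> \<le> 2 * (norm a * \<epsilon>)"
        using hyp_nbhd_inner_bound[OF a, of x b \<epsilon>] hyp_nbhd_inner_bound[OF a, of y b \<epsilon>] x y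
        unfolding L v_def inner_diff_right by linarith
      then show ?thesis using mult_right_mono[OF na eps] by linarith
    qed
    moreover have "\<bar>\<Sum>j\<in>UNIV - {i}. a $ j * v $ j\<bar> \<le> ?n * \<bar>a $ i\<bar> * \<epsilon>"
    proof -
      have "\<bar>\<Sum>j\<in>UNIV - {i}. a $ j * v $ j\<bar> \<le> (\<Sum>j\<in>UNIV - {i}. \<bar>a $ j * v $ j\<bar>)"
        by (rule sum_abs)
      also have "\<dots> \<le> (\<Sum>j\<in>UNIV - {i}. \<bar>a $ i\<bar> * \<epsilon>)"
        using i close eps by (intro sum_mono) (auto simp: abs_mult v_def intro!: mult_mono)
      also have "\<dots> \<le> (\<Sum>j\<in>(UNIV::'n set). \<bar>a $ i\<bar> * \<epsilon>)"
        using eps by (intro sum_mono2) auto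
      finally show ?thesis by (simp add: mult.assoc)
    qed
    ultimately have "\<bar>a $ i\<bar> * \<bar>v $ i\<bar> \<le> \<bar>a $ i\<bar> * (3 * ?n * \<epsilon>)"
      by (simp add: abs_mult algebra_simps)
    then have vi: "\<bar>v $ i\<bar> \<le> 3 * ?n * \<epsilon>" using ai by simp
    have "1 * \<epsilon> \<le> (3 * ?n) * \<epsilon>" using n1 eps by (intro mult_right_mono) linarith+
    then show "\<bar>y $ j - x $ j\<bar> \<le> 3 * ?n * \<epsilon>"
      using vi close[of j] by (cases "j = i") (auto simp: v_def)
  qed
qed

text \<open>
  The remaining \<open>n - 1\<close> coordinates are cut into a grid of mesh \<open>\<epsilon>\<close>. Two points of the slab in the
  same grid cell are then close in all \<open>n\<close> coordinates, so one ball per occupied cell suffices.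
  Centres are chosen inside the given set, so that they can be kept in the unit cube, where local
  maximal dimension gives information.
\<close>

lemma slab_cover:
  fixes L :: "(real^'n) set" and z :: "real^'n"
  assumes L: "affine_hyperplane L" and eps: "0 < \<epsilon>" "\<epsilon> \<le> r"
    and S: "S \<subseteq> ball z r \<inter> hyp_nbhd L \<epsilon>"
  obtains X where "finite X" "X \<subseteq> S" "real (card X) \<le> (4 * r / \<epsilon>) ^ (CARD('n) - 1)"
    "S \<subseteq> (\<Union>x\<in>X. sup_ball x (4 * real CARD('n) * \<epsilon>))"
proof -
  let ?n = "real CARD('n)"
  obtain i where i: "\<And>x y \<epsilon> j. \<lbrakk>x \<in> hyp_nbhd L \<epsilon>; y \<in> hyp_nbhd L \<epsilon>;
      \<And>j. j \<noteq> i \<Longrightarrow> \<bar>y $ j - x $ j\<bar> \<le> \<epsilon>\<rbrakk> \<Longrightarrow> \<bar>y $ j - x $ j\<bar> \<le> 3 * ?n * \<epsilon>"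
    using slab_dominant_coordinate[OF L] by blast
  define cell where "cell x = restrict (\<lambda>j. \<lfloor>(x $ j - z $ j) / \<epsilon>\<rfloor>) (UNIV - {i})" for x :: "real^'n"
  define R where "R = r / \<epsilon>"
  have R: "1 \<le> R" using eps by (simp add: R_def)
  define K where "K = {\<lfloor>-R\<rfloor>..\<lfloor>R\<rfloor>}"
  \<comment> \<open>At most \<open>2R + 2\<close> cells per axis; the hypothesis \<open>\<epsilon> \<le> r\<close> absorbs the constant term.\<close>
  have cardK: "real (card K) \<le> 4 * R"
  proof -
    have "real (card K) = real_of_int (\<lfloor>R\<rfloor> - \<lfloor>-R\<rfloor> + 1)"
      unfolding K_def card_atLeastAtMost_int using R by (subst of_nat_nat) linarith+
    then show ?thesis using R by linarith
  qed
  have cells: "cell ` S \<subseteq> PiE (UNIV - {i}) (\<lambda>_. K)"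
  proof (rule image_subsetI)
    fix x assume "x \<in> S"
    then have xz: "dist z x < r" using S by auto
    have "\<lfloor>(x $ j - z $ j) / \<epsilon>\<rfloor> \<in> K" for j
    proof -
      from xz have "\<bar>x $ j - z $ j\<bar> < r"
        using component_le_norm_cart[of "x - z" j] by (simp add: dist_norm norm_minus_commute)
      then have "\<bar>(x $ j - z $ j) / \<epsilon>\<bar> \<le> R"
        using eps by (simp add: R_def divide_right_mono)
      then have "-R \<le> (x $ j - z $ j) / \<epsilon>" "(x $ j - z $ j) / \<epsilon> \<le> R" by linarith+
      then show ?thesis
        unfolding K_def atLeastAtMost_iff by (intro conjI floor_mono)
    qed
    then show "cell x \<in> PiE (UNIV - {i}) (\<lambda>_. K)" by (auto simp: cell_def)
  qed
  have finPi: "finite (PiE (UNIV - {i}) (\<lambda>_. K))" by (intro finite_PiE) (auto simp: K_def)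
  have fin: "finite (cell ` S)" by (rule finite_subset[OF cells finPi])
  define X where "X = inv_into S cell ` cell ` S"
  show ?thesis
  proof (rule that)
    show "finite X" using fin by (simp add: X_def)
    show "X \<subseteq> S" by (auto simp: X_def inv_into_into)
    have "card X \<le> card (cell ` S)" unfolding X_def by (rule card_image_le[OF fin])
    also have "\<dots> \<le> card (PiE (UNIV - {i}) (\<lambda>_. K))" by (rule card_mono[OF finPi cells])
    also have "\<dots> = card K ^ (CARD('n) - 1)" by (simp add: card_PiE)
    finally have "real (card X) \<le> real (card K) ^ (CARD('n) - 1)"
      by (metis of_nat_le_iff of_nat_power)
    also have "\<dots> \<le> (4 * r / \<epsilon>) ^ (CARD('n) - 1)"
      using cardK by (intro power_mono) (auto simp: R_def)
    finally show "real (card X) \<le> (4 * r / \<epsilon>) ^ (CARD('n) - 1)" .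
    show "S \<subseteq> (\<Union>x\<in>X. sup_ball x (4 * ?n * \<epsilon>))"
    proof
      fix y assume y: "y \<in> S"
      define x where "x = inv_into S cell (cell y)"
      have x: "x \<in> S" "cell x = cell y" "x \<in> X"
        using y by (auto simp: x_def X_def inv_into_into f_inv_into_f)
      have "\<bar>y $ j - x $ j\<bar> \<le> \<epsilon>" if "j \<noteq> i" for j
      proof -
        have "\<lfloor>(x $ j - z $ j) / \<epsilon>\<rfloor> = \<lfloor>(y $ j - z $ j) / \<epsilon>\<rfloor>"
          using fun_cong[OF x(2), of j] that by (simp add: cell_def)
        then have "\<bar>(y $ j - z $ j) / \<epsilon> - (x $ j - z $ j) / \<epsilon>\<bar> \<le> 1" by linarith
        then have "\<bar>(y $ j - x $ j) / \<epsilon>\<bar> \<le> 1" by (simp add: diff_divide_distrib)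
        then show ?thesis using eps by (simp add: abs_divide)
      qed
      then have "\<bar>y $ j - x $ j\<bar> \<le> 3 * ?n * \<epsilon>" for j
        using i[of x \<epsilon> y j] x y S by auto
      moreover have "3 * ?n * \<epsilon> < 4 * ?n * \<epsilon>" using eps by simp
      ultimately have "y \<in> sup_ball x (4 * ?n * \<epsilon>)"
        by (intro mem_sup_ball_if_coords) (meson le_less_trans)
      then show "y \<in> (\<Union>x\<in>X. sup_ball x (4 * ?n * \<epsilon>))" using x(3) by blast
    qed
  qed
qed

section \<open>Absolute decay\<close>

text \<open>
  The hypothesis \<open>dim\<close> is the inequality of local maximal dimension at loss \<open>1/2\<close>, and
  \<open>dbl\<close> is what the Federer condition contributes: comparison of two concentric balls whose
  radii have a fixed ratio. The ratio \<open>n + 1\<close> is what the ball of radius \<open>r\<close> needs in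
  order to absorb a sup-norm ball of radius \<open>r\<close> around any of its points. Widths \<open>\<epsilon>\<close> that
  are not small against \<open>r\<close> are harmless, since then \<open>(\<epsilon>/r)\<^bsup>1/2\<^esup>\<close> is bounded below; they account for
  the summand \<open>(4n)\<^bsup>1/2\<^esup>\<close>.
\<close>

lemma slab_measure_le:
  fixes \<mu> :: "(real^'n) measure" and z :: "real^'n"
  defines "n \<equiv> real CARD('n)"
  assumes fm: "finite_measure \<mu>" and sets: "sets \<mu> = sets borel"
    and cube: "AE x in \<mu>. x \<in> cbox 0 1"
    and C0: "0 < C0" and D: "0 < D" and r: "0 < r" "r \<le> s0"
    and dim: "\<And>\<delta> s x. \<lbrakk>x \<in> cbox 0 1; 0 < \<delta>; \<delta> < 1; 0 < s; s \<le> s0\<rbrakk> \<Longrightarrow>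
        measure \<mu> (sup_ball x (\<delta> * s)) \<le> C0 * \<delta> powr (n - 1/2) * measure \<mu> (sup_ball x s)"
    and dbl: "measure \<mu> (ball z ((n + 1) * r)) \<le> D * measure \<mu> (ball z r)"
    and L: "affine_hyperplane L" and eps: "0 < \<epsilon>"
  shows "measure \<mu> (ball z r \<inter> hyp_nbhd L \<epsilon>)
    \<le> (C0 * D * 4 powr (n - 1) * (4 * n) powr (n - 1/2) + (4 * n) powr (1/2))
        * (\<epsilon> / r) powr (1/2) * measure \<mu> (ball z r)"
    (is "_ \<le> (?A + ?A') * ?q * ?M")
proof -
  interpret finite_measure \<mu> by (rule fm)
  have meas: "W \<in> sets \<mu>" if "open W" for W
    using that sets by (simp add: borel_open)
  have n1: "1 \<le> n" unfolding n_def using zero_less_card_finite[where 'a='n] by linarith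
  have A0: "0 \<le> ?A" "0 \<le> ?A'" "0 \<le> ?M" "0 \<le> ?q" using C0 D by auto
  show ?thesis
  proof (cases "4 * n * \<epsilon> < r")
    case False
    have "1 \<le> (4 * n * (\<epsilon> / r)) powr (1/2)"
      using False r by (intro ge_one_powr_ge_zero) (auto simp: field_simps)
    also have "\<dots> = ?A' * ?q" using n1 eps r by (subst powr_mult[symmetric]) auto
    also have "\<dots> \<le> (?A + ?A') * ?q" using A0 by (intro mult_right_mono) auto
    finally have "1 * ?M \<le> (?A + ?A') * ?q * ?M" using A0 by (intro mult_right_mono)
    moreover have "measure \<mu> (ball z r \<inter> hyp_nbhd L \<epsilon>) \<le> ?M"
      by (intro finite_measure_mono meas) auto
    ultimately show ?thesis by linarith
  next
    case True
    have "1 * \<epsilon> \<le> (4 * n) * \<epsilon>" using n1 eps by (intro mult_right_mono) auto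
    then have er: "\<epsilon> \<le> r" using True by simp
    define t where "t = \<epsilon> / r"
    have t: "0 < t" using eps r by (simp add: t_def)
    define S where "S = ball z r \<inter> hyp_nbhd L \<epsilon> \<inter> cbox 0 1"
    have Ssub: "S \<subseteq> ball z r \<inter> hyp_nbhd L \<epsilon>" by (auto simp: S_def)
    obtain X where X: "finite X" "X \<subseteq> S" "real (card X) \<le> (4 * r / \<epsilon>) ^ (CARD('n) - 1)"
        "S \<subseteq> (\<Union>x\<in>X. sup_ball x (4 * n * \<epsilon>))"
      by (rule slab_cover[OF L eps er Ssub, folded n_def]) (rule that)
    have one: "measure \<mu> (sup_ball x (4 * n * \<epsilon>)) \<le> C0 * (4 * n * t) powr (n - 1/2) * (D * ?M)"
      if "x \<in> X" for x
    proof -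
      have x: "x \<in> cbox 0 1" "dist z x < r" using that X(2) by (auto simp: S_def)
      have "sup_ball x r \<subseteq> ball x (n * r)"
        using sup_ball_subset_ball[OF r(1)] by (simp add: n_def)
      also have "\<dots> \<subseteq> ball z ((n + 1) * r)"
        using x(2) by (subst ball_subset_ball_iff) (auto simp: algebra_simps dist_commute)
      finally have "measure \<mu> (sup_ball x r) \<le> measure \<mu> (ball z ((n + 1) * r))"
        by (intro finite_measure_mono meas) auto
      then have le: "measure \<mu> (sup_ball x r) \<le> D * ?M" using dbl by simp
      have "measure \<mu> (sup_ball x ((4 * n * t) * r))
          \<le> C0 * (4 * n * t) powr (n - 1/2) * measure \<mu> (sup_ball x r)"
        using True t n1 r by (intro dim x) (auto simp: t_def field_simps)
      also have "\<dots> \<le> C0 * (4 * n * t) powr (n - 1/2) * (D * ?M)"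
        using C0 by (intro mult_left_mono le) auto
      finally show ?thesis using r by (simp add: t_def)
    qed
    have "measure \<mu> (ball z r \<inter> hyp_nbhd L \<epsilon>) = measure \<mu> S"
    proof (rule finite_measure_eq_AE)
      show "S \<in> sets \<mu>" unfolding S_def sets
        by (intro sets.Int borel_open borel_closed open_ball open_hyp_nbhd closed_cbox)
      show "AE x in \<mu>. x \<in> ball z r \<inter> hyp_nbhd L \<epsilon> \<longleftrightarrow> x \<in> S"
        using cube by (auto simp: S_def elim: eventually_mono)
    qed (intro meas open_Int open_ball open_hyp_nbhd)
    also have "\<dots> \<le> measure \<mu> (\<Union>x\<in>X. sup_ball x (4 * n * \<epsilon>))"
      by (intro finite_measure_mono X meas open_UN ballI open_sup_ball)
    also have "\<dots> \<le> (\<Sum>x\<in>X. measure \<mu> (sup_ball x (4 * n * \<epsilon>)))"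
      by (intro measure_UNION_le X(1) meas open_sup_ball)
    also have "\<dots> \<le> real (card X) * (C0 * (4 * n * t) powr (n - 1/2) * (D * ?M))"
      using one by (rule sum_bounded_above)
    also have "\<dots> \<le> (4 / t) powr (n - 1) * (C0 * (4 * n * t) powr (n - 1/2) * (D * ?M))"
    proof (rule mult_right_mono)
      have "(4 * r / \<epsilon>) ^ (CARD('n) - 1) = (4 / t) powr real (CARD('n) - 1)"
        using eps r by (subst powr_realpow) (auto simp: t_def)
      then show "real (card X) \<le> (4 / t) powr (n - 1)"
        using X(3) by (simp add: n_def of_nat_diff Suc_leI)
    qed (use C0 D in auto)
    also have "\<dots> = ?A * (t powr (n - 1/2) / t powr (n - 1)) * ?M"
      using t n1 by (simp add: powr_mult powr_divide)
    also have "t powr (n - 1/2) / t powr (n - 1) = ?q"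
      by (simp add: powr_diff[symmetric] t_def)
    also have "?A * ?q * ?M \<le> (?A + ?A') * ?q * ?M"
      using A0 by (intro mult_right_mono) auto
    finally show ?thesis .
  qed
qed

lemma absolutely_decaying_if_federer:
  fixes \<mu> :: "(real^'n) measure"
  assumes fm: "finite_measure \<mu>" and sets: "sets \<mu> = sets borel"
    and cube: "AE x in \<mu>. x \<in> cbox 0 1"
    and lmd: "local_maximal_dimension \<mu>" and fed: "federer \<mu>"
  shows "absolutely_decaying \<mu>"
proof -
  define n where "n = real CARD('n)"
  have n0: "0 < n" by (simp add: n_def)
  obtain s0 where s0: "0 < s0" and lmd_all: "\<forall>\<epsilon>>0. \<exists>C>0. \<forall>\<delta> s. \<forall>x\<in>cbox 0 (1 :: real^'n).
        0 < \<delta> \<and> \<delta> < 1 \<and> 0 < s \<and> s \<le> s0 \<longrightarrow>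
        measure \<mu> (sup_ball x (\<delta> * s)) \<le> C * \<delta> powr (n - \<epsilon>) * measure \<mu> (sup_ball x s)"
    using lmd unfolding local_maximal_dimension_def n_def by blast
  obtain C0 where C0: "0 < C0" and dim0: "\<forall>\<delta> s. \<forall>x\<in>cbox 0 (1 :: real^'n).
        0 < \<delta> \<and> \<delta> < 1 \<and> 0 < s \<and> s \<le> s0 \<longrightarrow>
        measure \<mu> (sup_ball x (\<delta> * s)) \<le> C0 * \<delta> powr (n - 1/2) * measure \<mu> (sup_ball x s)"
    using lmd_all[rule_format, OF half_gt_zero[OF zero_less_one]] by blast
  have dim: "measure \<mu> (sup_ball x (\<delta> * s)) \<le> C0 * \<delta> powr (n - 1/2) * measure \<mu> (sup_ball x s)"
    if "x \<in> cbox 0 (1 :: real^'n)" "0 < \<delta>" "\<delta> < 1" "0 < s" "s \<le> s0" for \<delta> s x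
    using dim0 that by blast
  have local: "\<exists>V C \<alpha>. open V \<and> y \<in> V \<and> 0 < C \<and> 0 < \<alpha> \<and> absolutely_decaying_on C \<alpha> \<mu> V"
    if ex: "\<exists>U. open U \<and> y \<in> U \<and> federer_on \<mu> U" for y
  proof -
    obtain U where U: "open U" "y \<in> U" "federer_on \<mu> U" using ex by blast
    obtain c \<beta> where c: "0 < c" and fed0: "\<forall>x \<in> msupp \<mu> \<inter> U. \<forall>\<delta> s.
        0 < \<delta> \<and> \<delta> \<le> s \<and> ball x s \<subseteq> U \<longrightarrow>
        measure \<mu> (ball x \<delta>) \<ge> c * (\<delta> / s) powr \<beta> * measure \<mu> (ball x s)"
      using U(3) unfolding federer_on_def by blast
    have fedU: "c * (\<delta> / s) powr \<beta> * measure \<mu> (ball x s) \<le> measure \<mu> (ball x \<delta>)"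
      if "x \<in> msupp \<mu> \<inter> U" "0 < \<delta>" "\<delta> \<le> s" "ball x s \<subseteq> U" for x \<delta> s
      using fed0[rule_format, OF that(1)] that(2-4) by simp
    obtain e where e: "0 < e" "ball y e \<subseteq> U" using U openE by blast
    \<comment> \<open>Small enough for the \<open>(n + 1)\<close>-fold enlargement of every ball in \<open>ball y \<rho>\<close> to lie in \<open>U\<close>.\<close>
    define \<rho> where "\<rho> = min s0 (e / (n + 2))"
    have \<rho>: "0 < \<rho>" "\<rho> \<le> s0" "\<rho> \<le> e / (n + 2)"
      using s0 e n0 by (auto simp: \<rho>_def)
    have \<rho>e: "(n + 2) * \<rho> \<le> e"
      using \<rho>(3) n0 by (simp add: pos_le_divide_eq mult.commute)
    define D where "D = (n + 1) powr \<beta> / c"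
    have D: "0 < D" using c n0 by (simp add: D_def)
    define C where "C = C0 * D * 4 powr (n - 1) * (4 * n) powr (n - 1/2) + (4 * n) powr (1/2)"
    have C: "0 < C" using C0 D n0 by (simp add: C_def add_pos_pos)
    have "absolutely_decaying_on C (1/2) \<mu> (ball y \<rho>)"
      unfolding absolutely_decaying_on_def
    proof (intro allI impI, elim conjE)
      fix z :: "real^'n" and r \<epsilon> :: real and L :: "(real^'n) set"
      assume z: "z \<in> msupp \<mu>" and r: "0 < r" and B: "ball z r \<subseteq> ball y \<rho>"
        and L: "affine_hyperplane L" and eps: "0 < \<epsilon>"
      have zr: "dist z y + r \<le> \<rho>" using B r by (simp add: ball_subset_ball_iff)
      then have rr: "r \<le> \<rho>" using zero_le_dist[of z y] by linarith
      have "dist z y + (n + 1) * r = (dist z y + r) + n * r" by (simp add: algebra_simps)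
      also have "\<dots> \<le> \<rho> + n * \<rho>"
        using zr rr n0 by (intro add_mono mult_left_mono) auto
      also have "\<dots> \<le> (n + 2) * \<rho>" using \<rho>(1) by (simp add: algebra_simps)
      finally have big: "ball z ((n + 1) * r) \<subseteq> U"
        using \<rho>e by (intro order_trans[OF _ e(2)]) (simp add: ball_subset_ball_iff)
      moreover have "z \<in> ball z ((n + 1) * r)" using r n0 by simp
      ultimately have zU: "z \<in> U" by blast
      have "c * (r / ((n + 1) * r)) powr \<beta> * measure \<mu> (ball z ((n + 1) * r)) \<le> measure \<mu> (ball z r)"
        using z zU r n0 big by (intro fedU) (auto simp: algebra_simps)
      also have "r / ((n + 1) * r) = 1 / (n + 1)" using r by simp
      finally have dbl: "measure \<mu> (ball z ((n + 1) * r)) \<le> D * measure \<mu> (ball z r)"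
        using c n0 by (simp add: D_def powr_divide field_simps)
      show "measure \<mu> (ball z r \<inter> hyp_nbhd L \<epsilon>) \<le> C * (\<epsilon> / r) powr (1/2) * measure \<mu> (ball z r)"
        using slab_measure_le[OF fm sets cube C0 D r order_trans[OF rr \<rho>(2)] dim[unfolded n_def]
            dbl[unfolded n_def] L eps]
        unfolding C_def n_def by blast
    qed
    then show ?thesis using C \<rho>(1)
      by (intro exI[of _ "ball y \<rho>"] exI[of _ C] exI[of _ "1/2"]) auto
  qed
  show ?thesis
    using fed unfolding federer_def absolutely_decaying_def
    by (rule eventually_mono) (rule local)
qed

section \<open>From absolute decay to friendliness\<close>

text \<open>
  Let \<open>d\<close> be the supremum of the distance to \<open>L\<close> over the support in a ball of radius \<open>r\<close>. By
  the Lipschitz property, the distance is at least \<open>d - 2r\<close> on the whole ball. If \<open>d > 4r\<close>, this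
  exceeds \<open>d/2\<close>, so the slab of width \<open>\<epsilon> d\<close> misses the ball unless \<open>\<epsilon> > 1/2\<close>, when a constant at
  least \<open>2\<^sup>\<alpha>\<close> makes the bound trivial. If \<open>d \<le> 4r\<close>, the slab has relative width at most \<open>4\<epsilon>\<close>.
\<close>

lemma decaying_on_if_absolutely_decaying_on:
  fixes \<mu> :: "(real^'n) measure"
  assumes fm: "finite_measure \<mu>" and sets: "sets \<mu> = sets borel"
    and C: "0 < C" and \<alpha>: "0 < \<alpha>" and dec: "absolutely_decaying_on C \<alpha> \<mu> U"
  shows "decaying_on (C * 4 powr \<alpha> + 2 powr \<alpha>) \<alpha> \<mu> U"
  unfolding decaying_on_def
proof (intro allI impI, elim conjE)
  interpret finite_measure \<mu> by (rule fm)
  have meas: "W \<in> sets \<mu>" if "open W" for W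
    using that sets by (simp add: borel_open)
  fix z :: "real^'n" and r \<epsilon> :: real and L :: "(real^'n) set"
  assume z: "z \<in> msupp \<mu>" and r: "0 < r" and B: "ball z r \<subseteq> U"
    and L: "affine_hyperplane L" and eps: "0 < \<epsilon>"
  let ?M = "measure \<mu> (ball z r)"
  let ?C = "C * 4 powr \<alpha> + 2 powr \<alpha>"
  define d where "d = dist_norm \<mu> (ball z r) L"
  have low: "d - 2 * r \<le> infdist x L" if x: "x \<in> ball z r" for x
  proof -
    have "d \<le> infdist x L + 2 * r"
      unfolding d_def dist_norm_def
    proof (rule cSUP_least)
      have "z \<in> ball z r \<inter> msupp \<mu>" using z r by simp
      then show "ball z r \<inter> msupp \<mu> \<noteq> {}" by blast
      fix y assume "y \<in> ball z r \<inter> msupp \<mu>"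
      then have "dist y x \<le> 2 * r"
        using x dist_triangle[of y x z] by (auto simp: dist_commute)
      then show "infdist y L \<le> infdist x L + 2 * r"
        using infdist_triangle[of y L x] by linarith
    qed
    then show ?thesis by linarith
  qed
  have Cpos: "0 \<le> ?C" using C by simp
  consider (null) "ball z r \<inter> hyp_nbhd L (\<epsilon> * d) = {}" | (thin) "0 < d" "d \<le> 4 * r"
    | (wide) "1/2 < \<epsilon>"
  proof (cases "d \<le> 0 \<or> (4 * r < d \<and> \<epsilon> \<le> 1/2)")
    case True
    have "ball z r \<inter> hyp_nbhd L (\<epsilon> * d) = {}"
    proof (rule ccontr)
      assume "ball z r \<inter> hyp_nbhd L (\<epsilon> * d) \<noteq> {}"
      then obtain x where x: "x \<in> ball z r" "infdist x L < \<epsilon> * d" by (auto simp: hyp_nbhd_def)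
      from True show False
      proof
        assume "d \<le> 0"
        then have "\<epsilon> * d \<le> 0" using eps by (simp add: mult_nonneg_nonpos)
        then show False using x infdist_nonneg[of x L] by linarith
      next
        assume d: "4 * r < d \<and> \<epsilon> \<le> 1/2"
        then have "\<epsilon> * d \<le> 1/2 * d" using r by (intro mult_right_mono) auto
        then show False using d x low[of x] by linarith
      qed
    qed
    then show ?thesis by (rule null)
  next
    case False
    then show ?thesis using thin wide by linarith
  qed
  then have "measure \<mu> (ball z r \<inter> hyp_nbhd L (\<epsilon> * d)) \<le> ?C * \<epsilon> powr \<alpha> * ?M"
  proof cases
    case null
    then show ?thesis using Cpos by simp
  next
    case thin
    have "measure \<mu> (ball z r \<inter> hyp_nbhd L (\<epsilon> * d)) \<le> C * (\<epsilon> * d / r) powr \<alpha> * ?M"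
      using dec z r B L eps thin unfolding absolutely_decaying_on_def by simp
    also have "\<dots> \<le> C * (4 * \<epsilon>) powr \<alpha> * ?M"
      using thin eps r C \<alpha>
      by (intro mult_right_mono mult_left_mono powr_mono2) (auto simp: field_simps)
    also have "\<dots> = C * 4 powr \<alpha> * \<epsilon> powr \<alpha> * ?M" using eps by (simp add: powr_mult)
    also have "\<dots> \<le> ?C * \<epsilon> powr \<alpha> * ?M" by (intro mult_right_mono) auto
    finally show ?thesis .
  next
    case wide
    have "1 \<le> (2 * \<epsilon>) powr \<alpha>" using wide \<alpha> by (intro ge_one_powr_ge_zero) auto
    also have "\<dots> = 2 powr \<alpha> * \<epsilon> powr \<alpha>" using eps by (simp add: powr_mult)
    also have "\<dots> \<le> ?C * \<epsilon> powr \<alpha>" using C by (intro mult_right_mono) auto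
    finally have "1 * ?M \<le> ?C * \<epsilon> powr \<alpha> * ?M" by (intro mult_right_mono) auto
    moreover have "measure \<mu> (ball z r \<inter> hyp_nbhd L (\<epsilon> * d)) \<le> ?M"
      by (intro finite_measure_mono meas) auto
    ultimately show ?thesis by linarith
  qed
  then show "measure \<mu> (ball z r \<inter> hyp_nbhd L (\<epsilon> * dist_norm \<mu> (ball z r) L)) \<le> ?C * \<epsilon> powr \<alpha> * ?M"
    by (simp only: d_def)
qed

lemma decaying_if_absolutely_decaying:
  fixes \<mu> :: "(real^'n) measure"
  assumes "finite_measure \<mu>" "sets \<mu> = sets borel" "absolutely_decaying \<mu>"
  shows "decaying \<mu>"
  using assms(3) unfolding absolutely_decaying_def decaying_def
proof (rule eventually_mono)
  fix y
  assume "\<exists>U C \<alpha>. open U \<and> y \<in> U \<and> 0 < C \<and> 0 < \<alpha> \<and> absolutely_decaying_on C \<alpha> \<mu> U"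
  then obtain U C \<alpha> where U: "open U" "y \<in> U" "0 < C" "0 < \<alpha>" "absolutely_decaying_on C \<alpha> \<mu> U"
    by blast
  have "decaying_on (C * 4 powr \<alpha> + 2 powr \<alpha>) \<alpha> \<mu> U"
    by (rule decaying_on_if_absolutely_decaying_on[OF assms(1,2) U(3-5)])
  moreover have "0 < C * 4 powr \<alpha> + 2 powr \<alpha>" using U(3) by (simp add: add_pos_pos)
  ultimately show "\<exists>U C \<alpha>. open U \<and> y \<in> U \<and> 0 < C \<and> 0 < \<alpha> \<and> decaying_on C \<alpha> \<mu> U"
    using U by blast
qed

text \<open>
  The neighbourhoods on which \<open>A\<close> is null cover almost every point, and countably many of them have
  the same union.
\<close>

lemma null_if_AE_locally_null:
  fixes \<mu> :: "('a :: second_countable_topology) measure"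
  assumes sets: "sets \<mu> = sets borel" and A: "A \<in> sets \<mu>"
    and loc: "AE y in \<mu>. \<exists>V. open V \<and> y \<in> V \<and> emeasure \<mu> (V \<inter> A) = 0"
  shows "emeasure \<mu> A = 0"
proof -
  define \<V> where "\<V> = {V. open V \<and> emeasure \<mu> (V \<inter> A) = 0}"
  obtain \<V>' where \<V>': "\<V>' \<subseteq> \<V>" "countable \<V>'" "\<Union>\<V>' = \<Union>\<V>"
    using Lindelof[of \<V>] by (auto simp: \<V>_def)
  have "(\<Union>V\<in>\<V>'. V \<inter> A) \<in> null_sets \<mu>"
    using \<V>'(1,2) A sets by (intro null_sets_UN' null_setsI) (auto simp: \<V>_def)
  then have "AE y in \<mu>. y \<notin> (\<Union>V\<in>\<V>'. V \<inter> A)" by (rule AE_not_in)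
  moreover have "AE y in \<mu>. y \<in> \<Union>\<V>'"
    using loc unfolding \<V>'(3) by (rule eventually_mono) (auto simp: \<V>_def)
  ultimately have "AE y in \<mu>. y \<notin> A" by eventually_elim auto
  then show ?thesis using A by (simp add: AE_iff_null_sets[symmetric] null_setsD1)
qed

lemma nonplanar_if_absolutely_decaying:
  fixes \<mu> :: "(real^'n) measure"
  assumes fm: "finite_measure \<mu>" and sets: "sets \<mu> = sets borel"
    and dec: "absolutely_decaying \<mu>"
  shows "nonplanar \<mu>"
  unfolding nonplanar_def
proof (intro allI impI)
  interpret finite_measure \<mu> by (rule fm)
  fix L :: "(real^'n) set" assume L: "affine_hyperplane L"
  have "closed L" using L by (auto simp: affine_hyperplane_def closed_hyperplane)
  then have Lm: "L \<in> sets \<mu>" using sets by (simp add: borel_closed)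
  have meas: "W \<in> sets \<mu>" if "open W" for W
    using that sets by (simp add: borel_open)
  have "AE y in \<mu>. \<exists>V. open V \<and> y \<in> V \<and> emeasure \<mu> (V \<inter> L) = 0"
    using dec unfolding absolutely_decaying_def
  proof (rule eventually_mono)
    fix y
    assume "\<exists>U C \<alpha>. open U \<and> y \<in> U \<and> 0 < C \<and> 0 < \<alpha> \<and> absolutely_decaying_on C \<alpha> \<mu> U"
    then obtain U C \<alpha> where U: "open U" "y \<in> U" "0 < C" "0 < \<alpha>" "absolutely_decaying_on C \<alpha> \<mu> U"
      by blast
    show "\<exists>V. open V \<and> y \<in> V \<and> emeasure \<mu> (V \<inter> L) = 0"
    proof (cases "y \<in> msupp \<mu>")
      case False
      then obtain V where V: "open V" "y \<in> V" "emeasure \<mu> V = 0"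
        by (auto simp: msupp_def not_less)
      have "emeasure \<mu> (V \<inter> L) \<le> emeasure \<mu> V" by (intro emeasure_mono meas V) auto
      then show ?thesis using V by auto
    next
      case True
      obtain r where r: "0 < r" "ball y r \<subseteq> U" using U openE by blast
      let ?b = "\<lambda>\<epsilon>. C * (\<epsilon> / r) powr \<alpha> * measure \<mu> (ball y r)"
      have le: "measure \<mu> (ball y r \<inter> L) \<le> ?b \<epsilon>" if "0 < \<epsilon>" for \<epsilon>
      proof -
        have "L \<subseteq> hyp_nbhd L \<epsilon>" using that by (auto simp: hyp_nbhd_def)
        then have "measure \<mu> (ball y r \<inter> L) \<le> measure \<mu> (ball y r \<inter> hyp_nbhd L \<epsilon>)"
          by (intro finite_measure_mono meas open_Int open_hyp_nbhd) auto
        also have "\<dots> \<le> ?b \<epsilon>"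
          using U(5) True r L that unfolding absolutely_decaying_on_def by blast
        finally show ?thesis .
      qed
      have "(?b \<longlongrightarrow> C * (0 / r) powr \<alpha> * measure \<mu> (ball y r)) (at_right 0)"
        using r U(4)
        by (intro tendsto_intros tendsto_powr2)
          (auto simp: eventually_at_right_less intro!: eventually_mono[OF eventually_at_right_less])
      then have "measure \<mu> (ball y r \<inter> L) \<le> C * (0 / r) powr \<alpha> * measure \<mu> (ball y r)"
        by (rule tendsto_lowerbound)
          (auto intro!: le eventually_mono[OF eventually_at_right_less])
      then have "emeasure \<mu> (ball y r \<inter> L) = 0"
        by (simp add: emeasure_eq_measure measure_le_0_iff)
      then show ?thesis using r by (intro exI[of _ "ball y r"]) auto
    qed
  qed
  then show "emeasure \<mu> L = 0" by (rule null_if_AE_locally_null[OF sets Lm])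
qed

theorem theorem3p6:
  fixes \<mu> :: "(real^'n) measure"
  assumes "prob_space \<mu>"
    and "sets \<mu> = sets borel"
    and "emeasure \<mu> (cbox 0 1) = 1"
    and "local_maximal_dimension \<mu>"
    and "federer \<mu>"
  shows "absolutely_decaying \<mu> \<and> friendly \<mu>"
proof -
  interpret prob_space \<mu> by (rule assms(1))
  have fm: "finite_measure \<mu>" by unfold_locales
  have "AE x in \<mu>. x \<in> cbox 0 1"
    using assms(2,3) by (intro AE_prob_1) (simp add: measure_def)
  then have ad: "absolutely_decaying \<mu>"
    using absolutely_decaying_if_federer[OF fm assms(2) _ assms(4,5)] by blast
  then show ?thesis
    unfolding friendly_def
    using assms(5) nonplanar_if_absolutely_decaying[OF fm assms(2)]
      decaying_if_absolutely_decaying[OF fm assms(2)] by blast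
qed

end
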